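(* For every integer $m\ge 2$ there is a graph $G$ having at least $m!$ pairwise nonisomorphic exact-distance square roots which are trees, i.e. there are trees $T_1,\dots,T_{m!}$, pairwise nonisomorphic, each satisfying $T_i^{[\sharp 2]}\cong G$.
   Context: All graphs are finite and simple. For a graph $H=(V,E)$, its exact-distance square $H^{[\sharp 2]}$ is the graph with vertex set $V$ in which distinct vertices $x,y$ are adjacent if and only if their distance in $H$ is exactly $2$. A graph $H$ is an exact-distance square root of $G$ if $H^{[\sharp 2]}$ is (isomorphic to) $G$. *)

theory Defs
  imports Graph_Theory.Graph_Theory
begin

text \<open>
  Finite simple graphs are rendered by \<^locale>\<open>pair_graph\<close>: finite, loop-free, symmetric
  arc sets without parallel arcs, an edge being a pair of opposite arcs.  The library constant
  \<^const>\<open>digraph_iso\<close> on such structures (via the coercion \<^const>\<open>with_proj\<close>) is ordinary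
  graph isomorphism.
\<close>

definition graph_dist :: "'a pair_pre_digraph \<Rightarrow> 'a \<Rightarrow> 'a \<Rightarrow> ereal" where
  "graph_dist H x y = wf_digraph.\<mu> (with_proj H) (\<lambda>_. 1) x y"

definition exact_distance_square :: "'a pair_pre_digraph \<Rightarrow> 'a pair_pre_digraph" where
  "exact_distance_square H =
     \<lparr> pverts = pverts H,
       parcs = {(x, y). x \<in> pverts H \<and> y \<in> pverts H \<and> x \<noteq> y \<and> graph_dist H x y = 2} \<rparr>"

definition exact_distance_square_root :: "'a pair_pre_digraph \<Rightarrow> 'b pair_pre_digraph \<Rightarrow> bool" where
  "exact_distance_square_root H G \<longleftrightarrow>
     pair_graph H \<and> digraph_iso (with_proj (exact_distance_square H)) (with_proj G)"

text \<open>
  The library predicate \<^const>\<open>tree\<close> is a digraph notion: in a symmetric digraph every edge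
  already yields a directed cycle of length 2, so it would only admit the one-vertex graph.
  Cycles of an undirected graph are the library cycles of length at least 3.
\<close>

definition undirected_tree :: "'a pair_pre_digraph \<Rightarrow> bool" where
  "undirected_tree T \<longleftrightarrow>
     pair_graph T \<and> connected (with_proj T) \<and>
     \<not> (\<exists>p. pre_digraph.cycle (with_proj T) p \<and> 3 \<le> length p)"

end

theory Submission
  imports Defs "HOL-Library.Countable"
begin

text \<open>
  The exact-distance square of a tree records its two colour classes but not how they are glued
  together.  Take a centre with hubs \<open>0, \<dots>, m - 1\<close> as neighbours, and give the hub \<open>\<sigma> i\<close> the
  \<open>m + i\<close> children \<open>Inner i l\<close>, the first of which gets the \<open>2m + \<sigma> i\<close> leaves \<open>Outer (\<sigma> i) l\<close>.
  Two vertices of a rooted tree are at distance 2 iff they are siblings or grandparent and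
  grandchild.  The sibling classes have one fixed label each, the grandparent of \<open>Inner i l\<close> is the centre
  and that of \<open>Outer j l\<close> is \<open>Hub j\<close>, so the square does not depend on the permutation \<open>\<sigma>\<close>.
  On the other hand the tree determines \<open>\<sigma>\<close> through the degrees along its edges.
\<close>

section \<open>Exact distance two\<close>

text \<open>Lengths are integers, so an infimum of walk lengths equal to 2 is attained, and a walk
  of length 2 amounts to its middle vertex \<open>w\<close>.\<close>

lemma (in pair_graph) graph_dist_eq_2_iff:
  assumes "x \<in> pverts G"
  shows "graph_dist G x y = 2 \<longleftrightarrow>
    x \<noteq> y \<and> (x, y) \<notin> parcs G \<and> (\<exists>w. (x, w) \<in> parcs G \<and> (w, y) \<in> parcs G)"
proof -
  have cost: "awalk_cost (\<lambda>_. 1) q = real (length q)" for q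
    by (induction q) auto
  have dist: "graph_dist G x y = (INF q\<in>{q. awalk x q y}. ereal (length q))"
    by (simp add: graph_dist_def \<mu>_def cost)
  have two: "(2::ereal) = ereal (real 2)"
    by simp
  have short: "(length q = 0 \<longrightarrow> x = y) \<and> (length q = 1 \<longrightarrow> (x, y) \<in> parcs G) \<and>
      (length q = 2 \<longrightarrow> (\<exists>w. (x, w) \<in> parcs G \<and> (w, y) \<in> parcs G))" if "awalk x q y" for q
    using that by (auto simp: awalk_Cons_iff awalk_Nil_iff length_Suc_conv numeral_2_eq_2)
  show ?thesis
  proof
    assume D: "graph_dist G x y = 2"
    have ge: "2 \<le> length q" if "awalk x q y" for q
    proof -
      have "ereal (real 2) \<le> ereal (length q)"
        using D that unfolding dist two by (metis INF_lower mem_Collect_eq)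
      then show ?thesis by simp
    qed
    \<comment> \<open>A bound strictly above 2 yields an actual walk; \<open>ge\<close> then leaves
      only length 2.\<close>
    have "(INF q\<in>{q. awalk x q y}. ereal (length q)) < ereal (real 3)"
      using D unfolding dist by simp
    then obtain q where q: "awalk x q y" "length q < 3"
      unfolding INF_less_iff by auto
    with ge have "length q = 2"
      by fastforce
    with q short obtain w where w: "(x, w) \<in> parcs G" "(w, y) \<in> parcs G"
      by blast
    moreover have "x \<noteq> y"
      using ge[of "[]"] assms by (auto simp: awalk_Nil_iff)
    moreover have "(x, y) \<notin> parcs G"
      using ge[of "[(x, y)]"] w by (auto simp: awalk_simps dest: in_arcsD1 in_arcsD2)
    ultimately show "x \<noteq> y \<and> (x, y) \<notin> parcs G \<and> (\<exists>w. (x, w) \<in> parcs G \<and> (w, y) \<in> parcs G)"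
      by blast
  next
    assume R: "x \<noteq> y \<and> (x, y) \<notin> parcs G \<and> (\<exists>w. (x, w) \<in> parcs G \<and> (w, y) \<in> parcs G)"
    then obtain w where w: "(x, w) \<in> parcs G" "(w, y) \<in> parcs G" by blast
    have "2 \<le> length q" if "awalk x q y" for q
      using short[OF that] R by (cases "length q" rule: nat.exhaust; cases "length q - 1") auto
    then have "ereal (real 2) \<le> graph_dist G x y"
      unfolding dist by (intro INF_greatest) (simp add: numeral_le_real_of_nat_iff)
    moreover have "awalk x [(x, w), (w, y)] y"
      using w by (auto simp: awalk_simps dest: in_arcsD2)
    then have "graph_dist G x y \<le> ereal (length [(x, w), (w, y)])"
      unfolding dist by (intro INF_lower) simp
    ultimately show "graph_dist G x y = 2"
      by (simp add: antisym)
  qed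
qed

lemma pair_graph_exact_distance_square:
  assumes "pair_graph H"
  shows "pair_graph (exact_distance_square H)"
proof -
  interpret pair_graph H by fact
  show ?thesis
  proof
    have "parcs (exact_distance_square H) \<subseteq> pverts H \<times> pverts H"
      by (auto simp: exact_distance_square_def)
    then show "finite (parcs (exact_distance_square H))"
      using finite_subset pair_finite_verts by blast
    have "graph_dist H y x = 2" if "x \<in> pverts H" "y \<in> pverts H" "graph_dist H x y = 2" for x y
      using that graph_dist_eq_2_iff arcs_symmetric by metis
    then show "symmetric (with_proj (exact_distance_square H))"
      by (auto simp only: symmetric_def exact_distance_square_def with_proj_simps
          pair_pre_digraph.simps mem_Collect_eq case_prod_conv intro!: symI)
  qed (use pair_finite_verts in \<open>auto simp: exact_distance_square_def\<close>)
qed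

lemma (in wf_digraph) digraph_iso_self: "digraph_iso G G"
  unfolding digraph_iso_def
proof (intro exI conjI)
  let ?h = "\<lparr>iso_verts = id, iso_arcs = id, iso_head = head G, iso_tail = tail G\<rparr>"
  show "digraph_isomorphism ?h"
    using wf_digraph_axioms by (auto simp: digraph_isomorphism_def)
  show "G = app_iso ?h G"
    by (simp add: app_iso_def)
qed

section \<open>Trees given by a parent function\<close>

text \<open>The guards against \<open>r\<close> let \<open>p\<close> take any value at the
  root.\<close>

definition parent_graph :: "'a set \<Rightarrow> 'a \<Rightarrow> ('a \<Rightarrow> 'a) \<Rightarrow> 'a pair_pre_digraph" where
  "parent_graph V r p = \<lparr>pverts = V, parcs =
     {(u, v). u \<in> V \<and> v \<in> V \<and> (u \<noteq> r \<and> v = p u \<or> v \<noteq> r \<and> u = p v)}\<rparr>"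

lemma parent_graph_simps [simp]:
  "pverts (parent_graph V r p) = V"
  "(u, v) \<in> parcs (parent_graph V r p) \<longleftrightarrow>
     u \<in> V \<and> v \<in> V \<and> (u \<noteq> r \<and> v = p u \<or> v \<noteq> r \<and> u = p v)"
  by (auto simp: parent_graph_def)

text \<open>\<open>d\<close> certifies acyclicity: it drops by one at each step to the parent, so
  iterating \<open>p\<close> must arrive at \<open>r\<close>.\<close>

locale parent_tree =
  fixes V :: "'a set" and r :: 'a and p :: "'a \<Rightarrow> 'a" and d :: "'a \<Rightarrow> nat"
  assumes finite_V: "finite V" and root: "r \<in> V"
    and parent_in: "v \<in> V \<Longrightarrow> v \<noteq> r \<Longrightarrow> p v \<in> V"
    and depth_parent: "v \<in> V \<Longrightarrow> v \<noteq> r \<Longrightarrow> d v = Suc (d (p v))"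
begin

abbreviation T where "T \<equiv> parent_graph V r p"

lemma pair_graph_T: "pair_graph T"
proof
  have "parcs T \<subseteq> V \<times> V" by auto
  then show "finite (parcs T)"
    using finite_subset finite_V by blast
  show "fst e \<noteq> snd e" if "e \<in> parcs T" for e
    using that depth_parent by (cases e) fastforce
  show "symmetric (with_proj T)"
    by (auto simp: symmetric_def intro!: symI)
qed (auto simp: finite_V)

sublocale pair_graph T
  by (rule pair_graph_T)

lemma adjacent_depth:
  "(u, v) \<in> parcs T \<Longrightarrow> d u = Suc (d v) \<or> d v = Suc (d u)"
  using depth_parent by auto

lemma adjacent_not_higher:
  "(u, v) \<in> parcs T \<Longrightarrow> d v \<le> d u \<Longrightarrow> v = p u"
  using depth_parent by fastforce

lemma reachable_root: "v \<in> V \<Longrightarrow> v \<rightarrow>\<^sup>*\<^bsub>with_proj T\<^esub> r"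
proof (induction "d v" arbitrary: v rule: less_induct)
  case less
  show ?case
  proof (cases "v = r")
    case False
    then have "(v, p v) \<in> parcs T"
      using less.prems parent_in by simp
    moreover have "p v \<rightarrow>\<^sup>*\<^bsub>with_proj T\<^esub> r"
      using less False parent_in depth_parent by simp
    ultimately show ?thesis
      by (rule adj_reachable_trans)
  qed (use root in auto)
qed

lemma connected_T: "connected (with_proj T)"
  unfolding connected_def
proof
  fix u v assume "u \<in> verts (with_proj (mk_symmetric (with_proj T)))"
    "v \<in> verts (with_proj (mk_symmetric (with_proj T)))"
  then have "u \<in> V" "v \<in> V" by auto
  then have "u \<rightarrow>\<^sup>*\<^bsub>with_proj T\<^esub> v"
    by (meson reachable_root reachable_trans symmetric_reachable sym_arcs)
  then show "u \<rightarrow>\<^sup>*\<^bsub>with_proj (mk_symmetric (with_proj T))\<^esub> v"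
    by (rule reachable_mk_symmetricI)
qed (use root in auto)

text \<open>A deepest vertex of a cycle would have the same vertex, its parent, on both sides.\<close>

lemma no_long_cycle:
  assumes "cycle c"
  shows "length c < 3"
proof (rule ccontr)
  assume "\<not> length c < 3"
  then have n: "3 \<le> length c" by simp
  obtain u where u: "awalk u c u" "distinct (tl (awalk_verts u c))"
    using assms by (auto simp: cycle_def)
  define n where "n = length c"
  define v where "v i = snd (c ! i)" for i
  have c: "c \<noteq> []" using n by auto
  have "tl (awalk_verts u c) = map snd c"
    using u(1) c awalk_verts_conv'[of u c u] by (auto simp: awalk_def)
  then have inj: "v i = v j \<longleftrightarrow> i = j" if "i < n" "j < n" for i j
    using u(2) that by (auto simp: v_def n_def distinct_conv_nth)
  \<comment> \<open>The vertex list reads as all tails plus the last head, or as \<open>u\<close>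
    plus all heads; comparing entries shows that consecutive arcs meet.\<close>
  have "map fst c @ [snd (last c)] = u # map snd c"
    using u(1) c awalk_verts_conv[of u c] awalk_verts_conv'[of u c u]
    by (auto simp: awalk_def cas_simp)
  then have verts: "(map fst c @ [snd (last c)]) ! i = (u # map snd c) ! i" for i
    by simp
  have chain: "fst (c ! Suc i) = v i" if "Suc i < n" for i
    using verts[of "Suc i"] that by (simp add: nth_append v_def n_def)
  have first: "fst (c ! 0) = v (n - 1)"
    using verts[of 0] awlast_if_cas[of u c u] u(1) c awalk_verts_conv[of u c]
    by (simp add: nth_append v_def n_def awalk_def last_conv_nth)
  have arc: "(fst (c ! i), v i) \<in> parcs T" if "i < n" for i
    using u(1) that by (auto simp: awalk_def v_def n_def)
  have "Max ((\<lambda>i. d (v i)) ` {..<n}) \<in> (\<lambda>i. d (v i)) ` {..<n}"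
    using c by (intro Max_in) (auto simp: n_def)
  then obtain i where max: "Max ((\<lambda>i. d (v i)) ` {..<n}) = d (v i)" and "i \<in> {..<n}"
    by (rule imageE)
  then have i: "i < n"
    by simp
  have top: "d (v j) \<le> d (v i)" if "j < n" for j
    unfolding max[symmetric] using that by (intro Max_ge) auto
  \<comment> \<open>Cyclic predecessor and successor of the deepest position \<open>i\<close>; they
    differ because the length is at least 3.\<close>
  define b where "b = (if i = 0 then n - 1 else i - 1)"
  define a where "a = (if Suc i = n then 0 else Suc i)"
  have "b < n" "a < n" "a \<noteq> b"
    using i n unfolding a_def b_def n_def[symmetric] by (split if_split, arith)+
  have "fst (c ! i) = v b"
    using chain[of "i - 1"] first i by (cases i) (simp_all add: b_def)
  then have "(v b, v i) \<in> parcs T"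
    using arc[OF i] by (simp only:)
  then have "v b = p (v i)"
    using adjacent_not_higher top \<open>b < n\<close> arcs_symmetric by blast
  moreover have "fst (c ! a) = v i"
    using chain[of i] first i by (cases "Suc i = n") (auto simp: a_def)
  then have "(v i, v a) \<in> parcs T"
    using arc[OF \<open>a < n\<close>] by (simp only:)
  then have "v a = p (v i)"
    using adjacent_not_higher top \<open>a < n\<close> by blast
  ultimately show False
    using inj \<open>a < n\<close> \<open>b < n\<close> \<open>a \<noteq> b\<close> by metis
qed

lemma undirected_tree_T: "undirected_tree T"
  using pair_graph_T connected_T no_long_cycle by (fastforce simp: undirected_tree_def)

text \<open>Depth changes by one along every edge, so there are no triangles and a common neighbour
  suffices. It is a common parent, or the parent of one endpoint and a child of the other; a common
  child would have two parents.\<close>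

lemma graph_dist_T_eq_2_iff:
  assumes "x \<in> V" "y \<in> V"
  shows "graph_dist T x y = 2 \<longleftrightarrow> x \<noteq> y \<and>
    (x \<noteq> r \<and> y \<noteq> r \<and> p x = p y \<or> x \<noteq> r \<and> p x \<noteq> r \<and> y = p (p x) \<or>
     y \<noteq> r \<and> p y \<noteq> r \<and> x = p (p y))"
proof -
  have "(x, y) \<notin> parcs T" if "(x, w) \<in> parcs T" "(w, y) \<in> parcs T" for w
  proof
    assume "(x, y) \<in> parcs T"
    with that show False
      using adjacent_depth[of x y] adjacent_depth[of x w] adjacent_depth[of w y] by linarith
  qed
  then have "graph_dist T x y = 2 \<longleftrightarrow>
      x \<noteq> y \<and> (\<exists>w. (x, w) \<in> parcs T \<and> (w, y) \<in> parcs T)"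
    using graph_dist_eq_2_iff[of x y] assms by auto
  then show ?thesis
    using assms parent_in by auto
qed

lemma out_degree_T:
  assumes "u \<in> V"
  shows "out_degree (with_proj T) u = card {w \<in> V. w \<noteq> r \<and> p w = u} + (if u = r then 0 else 1)"
proof -
  let ?C = "{w \<in> V. w \<noteq> r \<and> p w = u}"
  have "out_arcs (with_proj T) u = Pair u ` (?C \<union> (if u = r then {} else {p u}))"
    using assms parent_in by (auto simp: out_arcs_def)
  then have "out_degree (with_proj T) u = card (?C \<union> (if u = r then {} else {p u}))"
    by (simp add: out_degree_def card_image inj_on_def)
  also have "\<dots> = card ?C + (if u = r then 0 else 1)"
  proof (cases "u = r")
    case False
    \<comment> \<open>Otherwise \<open>p u\<close> would lie both one level above and one level
      below \<open>u\<close>.\<close>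
    then have "p u \<notin> ?C"
      using depth_parent[of u] depth_parent[of "p u"] assms by auto
    then show ?thesis
      using False finite_V by simp
  qed simp
  finally show ?thesis .
qed

end

text \<open>The distance-2 criterion sees a parent function only through sibling classes, children
  of the root and grandparents; the parents themselves may differ.\<close>

lemma exact_distance_square_parent_graph_eq:
  assumes "parent_tree V r p d" "parent_tree V r q d'"
    and "\<And>x y. x \<in> V - {r} \<Longrightarrow> y \<in> V - {r} \<Longrightarrow> p x = p y \<longleftrightarrow> q x = q y"
    and "\<And>x. x \<in> V - {r} \<Longrightarrow> p x = r \<longleftrightarrow> q x = r"
    and "\<And>x. x \<in> V - {r} \<Longrightarrow> p x \<noteq> r \<Longrightarrow> p (p x) = q (q x)"
  shows "exact_distance_square (parent_graph V r p) = exact_distance_square (parent_graph V r q)"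
proof -
  have "graph_dist (parent_graph V r p) x y = 2 \<longleftrightarrow> graph_dist (parent_graph V r q) x y = 2"
    if "x \<in> V" "y \<in> V" for x y
  proof -
    have "x \<noteq> r \<Longrightarrow> y \<noteq> r \<Longrightarrow> p x = p y \<longleftrightarrow> q x = q y"
      using assms(3) that by simp
    moreover have "z \<noteq> r \<Longrightarrow> p z = r \<longleftrightarrow> q z = r"
      and "z \<noteq> r \<Longrightarrow> p z \<noteq> r \<Longrightarrow> p (p z) = q (q z)" if "z = x \<or> z = y" for z
      using assms(4,5)[of z] that \<open>x \<in> V\<close> \<open>y \<in> V\<close> by auto
    ultimately show ?thesis
      unfolding parent_tree.graph_dist_T_eq_2_iff[OF assms(1) that]
        parent_tree.graph_dist_T_eq_2_iff[OF assms(2) that]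
      by (smt (verit))
  qed
  then show ?thesis
    by (auto simp: exact_distance_square_def)
qed

section \<open>Spiders indexed by permutations\<close>

datatype spider_vertex = Centre | Hub nat | Inner nat nat | Outer nat nat

instance spider_vertex :: countable
  by countable_datatype

fun spider_depth :: "spider_vertex \<Rightarrow> nat" where
  "spider_depth Centre = 0"
| "spider_depth (Hub j) = 1"
| "spider_depth (Inner i l) = 2"
| "spider_depth (Outer j l) = 3"

text \<open>Leaves carry the index of their hub, hence \<open>inv \<sigma>\<close>: the grandparent
  of \<open>Outer j l\<close> is \<open>Hub j\<close> for every permutation. The value at
  \<open>Centre\<close> is a dummy.\<close>

fun spider_parent :: "(nat \<Rightarrow> nat) \<Rightarrow> spider_vertex \<Rightarrow> spider_vertex" where
  "spider_parent \<sigma> Centre = Centre"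
| "spider_parent \<sigma> (Hub j) = Centre"
| "spider_parent \<sigma> (Inner i l) = Hub (\<sigma> i)"
| "spider_parent \<sigma> (Outer j l) = Inner (inv \<sigma> j) 0"

text \<open>The sizes encode labels as degrees: hubs get m+1 to 2m, the vertices
  \<open>Inner i 0\<close> get 2m+1 to 3m. As \<open>m + i\<close> is positive for
  \<open>i < m\<close>, \<open>Inner i 0\<close> is present.\<close>

fun in_spider :: "nat \<Rightarrow> spider_vertex \<Rightarrow> bool" where
  "in_spider m Centre \<longleftrightarrow> True"
| "in_spider m (Hub j) \<longleftrightarrow> j < m"
| "in_spider m (Inner i l) \<longleftrightarrow> i < m \<and> l < m + i"
| "in_spider m (Outer j l) \<longleftrightarrow> j < m \<and> l < 2 * m + j"

text \<open>The encoding moves the graphs to the vertex type \<open>nat\<close> of the final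
  statement.\<close>

definition spider_verts :: "nat \<Rightarrow> nat set" where
  "spider_verts m = to_nat ` Collect (in_spider m)"

definition nat_parent :: "(nat \<Rightarrow> nat) \<Rightarrow> nat \<Rightarrow> nat" where
  "nat_parent \<sigma> = to_nat \<circ> spider_parent \<sigma> \<circ> from_nat"

definition spider :: "nat \<Rightarrow> (nat \<Rightarrow> nat) \<Rightarrow> nat pair_pre_digraph" where
  "spider m \<sigma> = parent_graph (spider_verts m) (to_nat Centre) (nat_parent \<sigma>)"

lemma nat_parent_to_nat [simp]: "nat_parent \<sigma> (to_nat v) = to_nat (spider_parent \<sigma> v)"
  by (simp add: nat_parent_def)

lemma to_nat_in_spider_verts [simp]: "to_nat v \<in> spider_verts m \<longleftrightarrow> in_spider m v"
  by (auto simp: spider_verts_def)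

lemma finite_in_spider: "finite (Collect (in_spider m))"
proof -
  have "Collect (in_spider m) \<subseteq> {Centre} \<union> Hub ` {..<m} \<union>
      case_prod Inner ` ({..<m} \<times> {..<2 * m}) \<union> case_prod Outer ` ({..<m} \<times> {..<3 * m})"
  proof
    fix v assume "v \<in> Collect (in_spider m)"
    then show "v \<in> {Centre} \<union> Hub ` {..<m} \<union>
      case_prod Inner ` ({..<m} \<times> {..<2 * m}) \<union> case_prod Outer ` ({..<m} \<times> {..<3 * m})"
      by (cases v) (auto simp: image_iff)
  qed
  then show ?thesis
    by (rule finite_subset) simp
qed

locale spider_perm =
  fixes m :: nat and \<sigma> :: "nat \<Rightarrow> nat"
  assumes perm: "\<sigma> permutes {..<m}"
begin

lemma perm_less [simp]: "\<sigma> i < m \<longleftrightarrow> i < m" "inv \<sigma> i < m \<longleftrightarrow> i < m"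
  using permutes_in_image[OF perm] permutes_in_image[OF permutes_inv[OF perm]] by auto

sublocale parent_tree "spider_verts m" "to_nat Centre" "nat_parent \<sigma>" "spider_depth \<circ> from_nat"
proof
  show "finite (spider_verts m)"
    by (simp add: spider_verts_def finite_in_spider)
next
  fix v assume "v \<in> spider_verts m" "v \<noteq> to_nat Centre"
  then obtain w where w: "v = to_nat w" "in_spider m w" "w \<noteq> Centre"
    by (auto simp: spider_verts_def)
  then show "nat_parent \<sigma> v \<in> spider_verts m"
    by (cases w) auto
  show "(spider_depth \<circ> from_nat) v = Suc ((spider_depth \<circ> from_nat) (nat_parent \<sigma> v))"
    using w by (cases w) auto
qed simp

lemma out_degree_spider:
  assumes "in_spider m v"
  shows "out_degree (with_proj (spider m \<sigma>)) (to_nat v) =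
    (case v of Centre \<Rightarrow> m | Hub j \<Rightarrow> Suc (m + inv \<sigma> j)
     | Inner i l \<Rightarrow> if l = 0 then Suc (2 * m + \<sigma> i) else 1 | Outer j l \<Rightarrow> 1)"
proof -
  let ?C = "{w. in_spider m w \<and> w \<noteq> Centre \<and> spider_parent \<sigma> w = v}"
  have "{w \<in> spider_verts m. w \<noteq> to_nat Centre \<and> nat_parent \<sigma> w = to_nat v} = to_nat ` ?C"
    by (auto simp: spider_verts_def)
  then have "out_degree (with_proj (spider m \<sigma>)) (to_nat v) = card ?C + (if v = Centre then 0 else 1)"
    using assms by (simp add: spider_def out_degree_T card_image)
  moreover have "?C = (case v of Centre \<Rightarrow> Hub ` {..<m}
      | Hub j \<Rightarrow> Inner (inv \<sigma> j) ` {..<m + inv \<sigma> j}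
      | Inner i l \<Rightarrow> if l = 0 then Outer (\<sigma> i) ` {..<2 * m + \<sigma> i} else {}
      | Outer j l \<Rightarrow> {})"
  proof (rule set_eqI)
    fix w
    show "w \<in> ?C \<longleftrightarrow> w \<in> (case v of Centre \<Rightarrow> Hub ` {..<m}
      | Hub j \<Rightarrow> Inner (inv \<sigma> j) ` {..<m + inv \<sigma> j}
      | Inner i l \<Rightarrow> if l = 0 then Outer (\<sigma> i) ` {..<2 * m + \<sigma> i} else {}
      | Outer j l \<Rightarrow> {})"
      using assms
      by (cases v; cases w) (auto simp: permutes_inverses[OF perm])
  qed
  ultimately show ?thesis
    by (simp only:) (cases v; simp add: card_image inj_on_def)
qed

end

section \<open>The common square, and recovery of the permutation\<close>

text \<open>Since both permutations are injective, the sibling classes are the same on either side: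
  all hubs together, and inner or outer vertices grouped by first index.\<close>

lemma exact_distance_square_spider_eq:
  assumes "\<sigma> permutes {..<m}" "\<tau> permutes {..<m}"
  shows "exact_distance_square (spider m \<sigma>) = exact_distance_square (spider m \<tau>)"
proof -
  interpret S: spider_perm m \<sigma> by unfold_locales fact
  interpret T: spider_perm m \<tau> by unfold_locales fact
  note inv_inj = permutes_inverses[OF assms(1)] permutes_inverses[OF assms(2)]
  have eqs: "\<sigma> i = \<sigma> j \<longleftrightarrow> i = j" "\<tau> i = \<tau> j \<longleftrightarrow> i = j"
    "inv \<sigma> i = inv \<sigma> j \<longleftrightarrow> i = j" "inv \<tau> i = inv \<tau> j \<longleftrightarrow> i = j" for i j
    using inv_inj by metis+
  show ?thesis
    unfolding spider_def
  proof (rule exact_distance_square_parent_graph_eq[OF S.parent_tree_axioms T.parent_tree_axioms])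
    fix x y assume "x \<in> spider_verts m - {to_nat Centre}" "y \<in> spider_verts m - {to_nat Centre}"
    then obtain x' y' where "x = to_nat x'" "y = to_nat y'" "x' \<noteq> Centre" "y' \<noteq> Centre"
      by (auto simp: spider_verts_def)
    then show "nat_parent \<sigma> x = nat_parent \<sigma> y \<longleftrightarrow> nat_parent \<tau> x = nat_parent \<tau> y"
      by (cases x'; cases y') (auto simp: eqs)
  next
    fix x assume "x \<in> spider_verts m - {to_nat Centre}"
    then obtain x' where x: "x = to_nat x'" "x' \<noteq> Centre"
      by (auto simp: spider_verts_def)
    then show "nat_parent \<sigma> x = to_nat Centre \<longleftrightarrow> nat_parent \<tau> x = to_nat Centre"
      by (cases x') auto
    \<comment> \<open>The dummy value at \<open>Centre\<close> makes this hold for hubs too.\<close>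
    show "nat_parent \<sigma> (nat_parent \<sigma> x) = nat_parent \<tau> (nat_parent \<tau> x)"
      using x by (cases x') (auto simp: inv_inj)
  qed
qed

text \<open>The permutation is read off the edges joining a vertex of degree \<open>m + 1 + i\<close> to one of
  degree \<open>2m + 1 + j\<close>; these ranges are disjoint and avoid the degrees \<open>1\<close> and \<open>m\<close> of the
  leaves and the centre.\<close>

lemma spider_iso_imp_eq:
  assumes \<sigma>: "\<sigma> permutes {..<m}" and \<tau>: "\<tau> permutes {..<m}"
    and iso: "digraph_iso (with_proj (spider m \<sigma>)) (with_proj (spider m \<tau>))"
  shows "\<sigma> = \<tau>"
proof
  interpret S: spider_perm m \<sigma> by unfold_locales fact
  interpret T: spider_perm m \<tau> by unfold_locales fact
  obtain h where h: "pre_digraph.digraph_isomorphism (with_proj (spider m \<sigma>)) h"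
    and eq: "with_proj (spider m \<tau>) = app_iso h (with_proj (spider m \<sigma>))"
    using iso by (auto simp: digraph_iso_def)
  interpret W: wf_digraph "with_proj (spider m \<sigma>)"
    unfolding spider_def by (rule S.wf_digraph_axioms)
  fix i
  show "\<sigma> i = \<tau> i"
  proof (cases "i < m")
    case i: True
    \<comment> \<open>The degrees at the ends of this edge, m+1+i and 2m+1+\<sigma> i, record the
      pair of \<open>i\<close> and \<open>\<sigma> i\<close>.\<close>
    define u where "u = iso_verts h (to_nat (Hub (\<sigma> i)))"
    define v where "v = iso_verts h (to_nat (Inner i 0))"
    have *: "in_spider m (Hub (\<sigma> i))" "in_spider m (Inner i 0)"
      using i by auto
    then have e: "(to_nat (Hub (\<sigma> i)), to_nat (Inner i 0)) \<in> arcs (with_proj (spider m \<sigma>))"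
      by (simp add: spider_def)
    \<comment> \<open>Tail and head are \<open>fst\<close> and \<open>snd\<close> in both graphs, so
      the image of an arc is the pair of the image vertices.\<close>
    have "iso_tail h = fst" "iso_head h = snd"
      using arg_cong[OF eq, of tail] arg_cong[OF eq, of head] by simp_all
    with W.iso_verts_tail[OF h e] W.iso_verts_head[OF h e]
    have "iso_arcs h (to_nat (Hub (\<sigma> i)), to_nat (Inner i 0)) = (u, v)"
      by (simp add: u_def v_def prod_eq_iff)
    with e have "(u, v) \<in> arcs (app_iso h (with_proj (spider m \<sigma>)))"
      by (metis arcs_app_iso imageI)
    then have arc: "(u, v) \<in> parcs (spider m \<tau>)"
      by (simp flip: eq)
    then have "u \<in> spider_verts m" "v \<in> spider_verts m"
      by (auto simp: spider_def)
    then obtain u' v' where uv: "u = to_nat u'" "v = to_nat v'" "in_spider m u'" "in_spider m v'"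
      by (auto simp: spider_verts_def)
    have "out_degree (with_proj (spider m \<tau>)) u = Suc (m + i)"
      using * S.out_degree_spider[OF *(1)] W.out_degree_app_iso_eq[OF h]
      by (simp add: u_def eq permutes_inverses[OF \<sigma>]) (simp add: spider_def)
    moreover have "out_degree (with_proj (spider m \<tau>)) v = Suc (2 * m + \<sigma> i)"
      using * S.out_degree_spider[OF *(2)] W.out_degree_app_iso_eq[OF h]
      by (simp add: v_def eq) (simp add: spider_def)
    ultimately have deg: "out_degree (with_proj (spider m \<tau>)) (to_nat u') = Suc (m + i)"
      "out_degree (with_proj (spider m \<tau>)) (to_nat v') = Suc (2 * m + \<sigma> i)"
      by (simp_all add: uv)
    \<comment> \<open>The degree exceeds both 1 and m but is at most 2m, which only hubs
      allow.\<close>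
    have "\<exists>j. u' = Hub j"
      using deg(1) T.out_degree_spider[OF uv(3)] i uv(3)
      by (cases u') (auto split: if_splits)
    \<comment> \<open>Hubs have degree at most 2m, so this degree occurs only at some
      \<open>Inner k 0\<close>, where it equals 2m+1+\<tau> k.\<close>
    moreover have "\<exists>k. v' = Inner k 0 \<and> \<tau> k = \<sigma> i"
      using deg(2) T.out_degree_spider[OF uv(4)] i uv(4)
      by (cases v') (auto split: if_splits dest: T.perm_less(2)[THEN iffD2])
    ultimately obtain j k where jk: "u' = Hub j" "v' = Inner k 0" "\<tau> k = \<sigma> i"
      by blast
    \<comment> \<open>The preserved edge makes \<open>Hub j\<close> the parent of
      \<open>Inner k 0\<close>; with \<open>inv \<tau> j = i\<close> this gives
      \<open>k = i\<close>.\<close>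
    then have "j = \<tau> k"
      using arc uv by (simp add: spider_def)
    moreover have "inv \<tau> j = i"
      using deg(1) T.out_degree_spider[OF uv(3)] jk by simp
    ultimately show ?thesis
      using jk permutes_inverses[OF \<tau>] by metis
  next
    case False
    then show ?thesis
      using permutes_not_in[OF \<sigma>] permutes_not_in[OF \<tau>] by simp
  qed
qed

section \<open>The family of m! roots\<close>

theorem theorem4:
  fixes m :: nat
  assumes "m \<ge> 2"
  shows "\<exists>G :: nat pair_pre_digraph. pair_graph G \<and>
    (\<exists>T :: nat \<Rightarrow> nat pair_pre_digraph.
       (\<forall>i \<in> {1..fact m}. undirected_tree (T i) \<and> exact_distance_square_root (T i) G) \<and>
       (\<forall>i \<in> {1..fact m}. \<forall>j \<in> {1..fact m}. i \<noteq> j \<longrightarrow>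
          \<not> digraph_iso (with_proj (T i)) (with_proj (T j))))"
proof -
  let ?P = "{\<sigma>. \<sigma> permutes {..<m}}"
  have "finite ?P"
    by (simp add: finite_permutations)
  then obtain h where "bij_betw h {1..card ?P} ?P"
    using ex_bij_betw_nat_finite_1 by blast
  then have h: "bij_betw h {1..fact m} ?P"
    by (simp add: card_permutations)
  then have perm: "h i permutes {..<m}" if "i \<in> {1..fact m}" for i
    using bij_betwE[OF h] that by blast
  \<comment> \<open>The identity serves as a representative; every permutation gives this same
    graph.\<close>
  define G where "G = exact_distance_square (spider m id)"
  have tree: "undirected_tree (spider m \<sigma>)" if "\<sigma> permutes {..<m}" for \<sigma>
  proof -
    interpret spider_perm m \<sigma> by unfold_locales fact
    show ?thesis by (simp add: spider_def undirected_tree_T)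
  qed
  then have pg: "pair_graph (spider m \<sigma>)" if "\<sigma> permutes {..<m}" for \<sigma>
    using that by (simp add: undirected_tree_def)
  then have G: "pair_graph G"
    unfolding G_def using pair_graph_exact_distance_square permutes_id by blast
  then interpret G: pair_graph G .
  \<comment> \<open>The squares are literally equal, so the isomorphism is the identity of
    \<open>G\<close>.\<close>
  have "exact_distance_square_root (spider m \<sigma>) G" if "\<sigma> permutes {..<m}" for \<sigma>
    using exact_distance_square_spider_eq[OF that permutes_id] pg[OF that] G.digraph_iso_self
    by (simp add: exact_distance_square_root_def G_def)
  moreover have "\<not> digraph_iso (with_proj (spider m (h i))) (with_proj (spider m (h j)))"
    if "i \<in> {1..fact m}" "j \<in> {1..fact m}" "i \<noteq> j" for i j
    using spider_iso_imp_eq perm that bij_betw_imp_inj_on[OF h] by (metis inj_onD)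
  ultimately have
    "(\<forall>i \<in> {1..fact m}. undirected_tree (spider m (h i)) \<and> exact_distance_square_root (spider m (h i)) G) \<and>
     (\<forall>i \<in> {1..fact m}. \<forall>j \<in> {1..fact m}. i \<noteq> j \<longrightarrow>
        \<not> digraph_iso (with_proj (spider m (h i))) (with_proj (spider m (h j))))"
    using tree perm by blast
  then show ?thesis
    by (intro exI[of _ G] conjI[OF G] exI[of _ "\<lambda>i. spider m (h i)"])
qed

end
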